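(* Let $\mathcal{X}$ be a category and $(\mathcal{E},\mathcal{M})$ a quasi factorization structure in $\mathcal{X}$. Suppose that every morphism in $\mathcal{M}$ is a quasi mono, that $\mathcal{M}$ has $\mathcal{X}$-pullbacks, and that $\mathcal{M}$ is closed under composition. Let $\mathbf{C}$ be a closure operator on $\mathcal{X}$ with respect to $\mathcal{M}$. (i) Let $\mathcal{M}$ be closed under composition with isomorphisms, and let $\mathbf{C}$ be quasi weakly hereditary and quasi idempotent and satisfy (QCD). Then $(\mathcal{E}^{QC},\mathcal{M}^{QC})$ is a quasi factorization structure in $\mathcal{X}$ if and only if $\mathcal{M}^{QC}\subseteq({}^{\downarrow}(\mathcal{M}^{QC}))^{\uparrow}$. (ii) If $(\mathcal{E}^{QC},\mathcal{M}^{QC})$ is a quasi factorization structure in $\mathcal{X}$, then $\mathcal{M}^{QC}$ is closed under composition and $\mathbf{C}$ satisfies (QCD).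
   Context: For a class $\mathcal{M}$ of morphisms and an object $X$, $\mathcal{M}/X$ is the class of all morphisms in $\mathcal{M}$ with codomain $X$. For a morphism $f$, $\langle f\rangle=\{fh : h\in\mathcal{X},\ fh\text{ defined}\}$. For morphisms $f,g$ with the same codomain, $f\leqslant g$ means $\langle f\rangle\subseteq\langle g\rangle$ (equivalently $f=gj$ for some $j$), and $f\sim g$ means $f\leqslant g$ and $g\leqslant f$. A morphism $f$ is a quasi mono if $fa=fb$ implies $\langle a\rangle=\langle b\rangle$ for all morphisms $a,b$. For $e:E\to X$ and $m:M\to X$, write $e\downarrow m$ if: whenever $e=mu$ for some $u:E\to M$, there is $w:X\to M$ with $mw\sim 1_X$. For $e:M\to E$ and $m:M\to X$, write $e\uparrow m$ if: for every $v:E\to X$ with $ve=m$ there is $w:E\to M$ with $mw\sim v$. For a class $\mathcal{H}$ of morphisms, ${}^{\downarrow}\mathcal{H}$ is the class of all morphisms $e$ with $e\downarrow h$ for all $h\in\mathcal{H}$ with the same codomain as $e$, and $\mathcal{H}^{\uparrow}$ is the class of all morphisms $m$ with $h\uparrow m$ for all $h\in\mathcal{H}$ with the same domain as $m$. A quasi factorization structure in $\mathcal{X}$ is a pair $(\mathcal{E},\mathcal{M})$ of classes of morphisms such that (a) every morphism $f$ factors as $f=me$ with $e\in\mathcal{E}$, $m\in\mathcal{M}$; (b) $\mathcal{E}\subseteq{}^{\downarrow}\mathcal{M}$ and $\mathcal{M}\subseteq\mathcal{E}^{\uparrow}$. $\mathcal{M}$ has $\mathcal{X}$-pullbacks if for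 all $m\in\mathcal{M}$ and all morphisms $f$ of $\mathcal{X}$ with the same codomain as $m$, the pullback $f^{-1}(m)$ of $m$ along $f$ exists and is in $\mathcal{M}$. $\mathcal{M}$ is closed under composition with isomorphisms if $m\in\mathcal{M}$, $\alpha$ an isomorphism and $m\alpha$ defined imply $m\alpha\in\mathcal{M}$. $\mathcal{X}$ has quasi right $\mathcal{M}$-factorizations if for every morphism $f:Y\to X$ there is $m_f\in\mathcal{M}/X$ (called a quasi right part of $f$) such that (a) $f=m_fg$ for some $g$; (b) if $m\in\mathcal{M}/X$ and $f=mg$ for some $g$, then $m_f=mh$ for some $h$. A quasi right part is determined up to $\sim$. A (general) closure operator $\mathbf{C}=(\mathbf{c}_X)_{X\in\mathcal{X}}$ on $\mathcal{X}$ with respect to $\mathcal{M}$ (where $\mathcal{X}$ has quasi right $\mathcal{M}$-factorizations) is a family of maps $\mathbf{c}_X:\mathcal{M}/X\to\mathcal{M}/X$ such that: (a) $m\leqslant\mathbf{c}_X(m)$ for all $m\in\mathcal{M}/X$; (b) if $m\leqslant m'$ in $\mathcal{M}/X$ then $\mathbf{c}_X(m)\leqslant\mathbf{c}_X(m')$; (c) for every $f:X\to Y$ and $m\in\mathcal{M}/X$, $m_{f\mathbf{c}_X(m)}\leqslant\mathbf{c}_Y(m_{fm})$. For $m:M\to X$ in $\mathcal{M}$, write $\mathbf{c}_X(m):\mathbf{c}_X(M)\to X$. $m\in\mathcal{M}/X$ is quasi $\mathbf{C}$-closed if $\mathbf{c}_X(m)\sim m$, and quasi $\mathbf{C}$-dense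 if $\mathbf{c}_X(m)\sim 1_X$. An arbitrary morphism $f$ is quasi $\mathbf{C}$-dense if $m_f$ is quasi $\mathbf{C}$-dense. $\mathcal{M}^{QC}$ is the class of quasi $\mathbf{C}$-closed members of $\mathcal{M}$ and $\mathcal{E}^{QC}$ the class of all quasi $\mathbf{C}$-dense morphisms of $\mathcal{X}$. $\mathbf{C}$ is quasi idempotent if $\mathbf{c}_X(\mathbf{c}_X(m))\sim\mathbf{c}_X(m)$ for all $X$ and $m\in\mathcal{M}/X$; quasi weakly hereditary if for every $m:M\to X$ in $\mathcal{M}$ there is a quasi $\mathbf{C}$-dense morphism $j_m:M\to\mathbf{c}_X(M)$ with $\mathbf{c}_X(m)j_m=m$. $\mathbf{C}$ satisfies (QCD) if compositions of quasi $\mathbf{C}$-dense morphisms are quasi $\mathbf{C}$-dense. *)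

theory Defs
  imports Main
begin

(* Categories are carrier-based: Cod, Comp, ... are unspecified off the carriers.
   Composition is in applicative order, so g \<cdot> f is "f first, then g". *)
record ('o, 'a) cat =
  Obj :: "'o set"
  Arr :: "'a set"
  Dom :: "'a \<Rightarrow> 'o"
  Cod :: "'a \<Rightarrow> 'o"
  Ide :: "'o \<Rightarrow> 'a"
  Comp :: "'a \<Rightarrow> 'a \<Rightarrow> 'a"  (infixr "\<cdot>\<index>" 70)

definition hom :: "('o, 'a, 'z) cat_scheme \<Rightarrow> 'o \<Rightarrow> 'o \<Rightarrow> 'a set" where
  "hom X A B = {f \<in> Arr X. Dom X f = A \<and> Cod X f = B}"

definition composable :: "('o, 'a, 'z) cat_scheme \<Rightarrow> 'a \<Rightarrow> 'a \<Rightarrow> bool" where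
  "composable X g f \<longleftrightarrow> g \<in> Arr X \<and> f \<in> Arr X \<and> Cod X f = Dom X g"

locale category =
  fixes X :: "('o, 'a, 'z) cat_scheme" (structure)
  assumes Dom_in_Obj: "f \<in> Arr X \<Longrightarrow> Dom X f \<in> Obj X"
    and Cod_in_Obj: "f \<in> Arr X \<Longrightarrow> Cod X f \<in> Obj X"
    and Ide_in_hom: "A \<in> Obj X \<Longrightarrow> Ide X A \<in> hom X A A"
    and Comp_in_hom: "composable X g f \<Longrightarrow> g \<cdot> f \<in> hom X (Dom X f) (Cod X g)"
    and Comp_Ide: "f \<in> Arr X \<Longrightarrow> f \<cdot> Ide X (Dom X f) = f"
    and Ide_Comp: "f \<in> Arr X \<Longrightarrow> Ide X (Cod X f) \<cdot> f = f"
    and Comp_assoc: "composable X h g \<Longrightarrow> composable X g f \<Longrightarrow> (h \<cdot> g) \<cdot> f = h \<cdot> (g \<cdot> f)"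

definition iso :: "('o, 'a, 'z) cat_scheme \<Rightarrow> 'a \<Rightarrow> bool" where
  "iso X f \<longleftrightarrow> f \<in> Arr X \<and>
    (\<exists>g \<in> hom X (Cod X f) (Dom X f).
      Comp X g f = Ide X (Dom X f) \<and> Comp X f g = Ide X (Cod X f))"

definition over :: "('o, 'a, 'z) cat_scheme \<Rightarrow> 'a set \<Rightarrow> 'o \<Rightarrow> 'a set" where
  "over X M A = {m \<in> M. Cod X m = A}"

definition sieve :: "('o, 'a, 'z) cat_scheme \<Rightarrow> 'a \<Rightarrow> 'a set" where
  "sieve X f = {Comp X f h | h. composable X f h}"

definition le :: "('o, 'a, 'z) cat_scheme \<Rightarrow> 'a \<Rightarrow> 'a \<Rightarrow> bool" where
  "le X f g \<longleftrightarrow> f \<in> Arr X \<and> g \<in> Arr X \<and> Cod X f = Cod X g \<and> sieve X f \<subseteq> sieve X g"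

definition equ :: "('o, 'a, 'z) cat_scheme \<Rightarrow> 'a \<Rightarrow> 'a \<Rightarrow> bool" where
  "equ X f g \<longleftrightarrow> le X f g \<and> le X g f"

definition quasi_mono :: "('o, 'a, 'z) cat_scheme \<Rightarrow> 'a \<Rightarrow> bool" where
  "quasi_mono X f \<longleftrightarrow> f \<in> Arr X \<and>
    (\<forall>a b. composable X f a \<and> composable X f b \<and> Comp X f a = Comp X f b
      \<longrightarrow> sieve X a = sieve X b)"

definition down_arrow :: "('o, 'a, 'z) cat_scheme \<Rightarrow> 'a \<Rightarrow> 'a \<Rightarrow> bool" where
  "down_arrow X e m \<longleftrightarrow>
    (\<forall>u \<in> hom X (Dom X e) (Dom X m). e = Comp X m u \<longrightarrow>
      (\<exists>w \<in> hom X (Cod X m) (Dom X m). equ X (Comp X m w) (Ide X (Cod X m))))"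

definition up_arrow :: "('o, 'a, 'z) cat_scheme \<Rightarrow> 'a \<Rightarrow> 'a \<Rightarrow> bool" where
  "up_arrow X e m \<longleftrightarrow>
    (\<forall>v \<in> hom X (Cod X e) (Cod X m). Comp X v e = m \<longrightarrow>
      (\<exists>w \<in> hom X (Cod X e) (Dom X m). equ X (Comp X m w) v))"

definition down_class :: "('o, 'a, 'z) cat_scheme \<Rightarrow> 'a set \<Rightarrow> 'a set" where
  "down_class X H = {e \<in> Arr X. \<forall>h \<in> H. Cod X h = Cod X e \<longrightarrow> down_arrow X e h}"

definition up_class :: "('o, 'a, 'z) cat_scheme \<Rightarrow> 'a set \<Rightarrow> 'a set" where
  "up_class X H = {m \<in> Arr X. \<forall>h \<in> H. Dom X h = Dom X m \<longrightarrow> up_arrow X h m}"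

definition quasi_factorization_structure ::
    "('o, 'a, 'z) cat_scheme \<Rightarrow> 'a set \<Rightarrow> 'a set \<Rightarrow> bool" where
  "quasi_factorization_structure X E M \<longleftrightarrow>
    E \<subseteq> Arr X \<and> M \<subseteq> Arr X \<and>
    (\<forall>f \<in> Arr X. \<exists>e \<in> E. \<exists>m \<in> M. composable X m e \<and> f = Comp X m e) \<and>
    E \<subseteq> down_class X M \<and> M \<subseteq> up_class X E"

text \<open>\<open>is_pullback X f m p q\<close>: the morphism \<open>p\<close>, with codomain
  \<open>Dom X f\<close>, is a pullback of \<open>m\<close> along \<open>f\<close>, and \<open>q\<close> is the other projection.\<close>
definition is_pullback :: "('o, 'a, 'z) cat_scheme \<Rightarrow> 'a \<Rightarrow> 'a \<Rightarrow> 'a \<Rightarrow> 'a \<Rightarrow> bool" where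
  "is_pullback X f m p q \<longleftrightarrow>
    composable X f p \<and> composable X m q \<and> Dom X p = Dom X q \<and> Comp X f p = Comp X m q \<and>
    (\<forall>a b. composable X f a \<and> composable X m b \<and> Dom X a = Dom X b \<and> Comp X f a = Comp X m b
      \<longrightarrow> (\<exists>!u. u \<in> hom X (Dom X a) (Dom X p) \<and> Comp X p u = a \<and> Comp X q u = b))"

text \<open>Pullbacks are only determined up to isomorphism, and \<open>M\<close> need not be closed under
  composition with isomorphisms; what is required is that some pullback lies in \<open>M\<close>.\<close>
definition has_pullbacks :: "('o, 'a, 'z) cat_scheme \<Rightarrow> 'a set \<Rightarrow> bool" where
  "has_pullbacks X M \<longleftrightarrow>
    (\<forall>m \<in> M. \<forall>f \<in> Arr X. Cod X f = Cod X m \<longrightarrow> (\<exists>p q. is_pullback X f m p q \<and> p \<in> M))"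

definition closed_under_comp :: "('o, 'a, 'z) cat_scheme \<Rightarrow> 'a set \<Rightarrow> bool" where
  "closed_under_comp X M \<longleftrightarrow> (\<forall>m \<in> M. \<forall>n \<in> M. composable X m n \<longrightarrow> Comp X m n \<in> M)"

definition closed_under_comp_iso :: "('o, 'a, 'z) cat_scheme \<Rightarrow> 'a set \<Rightarrow> bool" where
  "closed_under_comp_iso X M \<longleftrightarrow>
    (\<forall>m \<in> M. \<forall>\<alpha>. iso X \<alpha> \<and> composable X m \<alpha> \<longrightarrow> Comp X m \<alpha> \<in> M)"

definition is_quasi_right_part :: "('o, 'a, 'z) cat_scheme \<Rightarrow> 'a set \<Rightarrow> 'a \<Rightarrow> 'a \<Rightarrow> bool" where
  "is_quasi_right_part X M f r \<longleftrightarrow>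
    r \<in> over X M (Cod X f) \<and>
    (\<exists>g. composable X r g \<and> f = Comp X r g) \<and>
    (\<forall>m \<in> over X M (Cod X f). (\<exists>g. composable X m g \<and> f = Comp X m g)
      \<longrightarrow> (\<exists>h. composable X m h \<and> r = Comp X m h))"

definition has_quasi_right_factorizations :: "('o, 'a, 'z) cat_scheme \<Rightarrow> 'a set \<Rightarrow> bool" where
  "has_quasi_right_factorizations X M \<longleftrightarrow> (\<forall>f \<in> Arr X. \<exists>r. is_quasi_right_part X M f r)"

text \<open>The chosen \<open>m\<^sub>f\<close>. By \<open>is_quasi_right_part_unique\<close> below the choice does not
  matter up to \<open>equ\<close>, and it is only used where it exists.\<close>
definition quasi_right_part :: "('o, 'a, 'z) cat_scheme \<Rightarrow> 'a set \<Rightarrow> 'a \<Rightarrow> 'a" where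
  "quasi_right_part X M f = (SOME r. is_quasi_right_part X M f r)"

definition closure_operator ::
    "('o, 'a, 'z) cat_scheme \<Rightarrow> 'a set \<Rightarrow> ('o \<Rightarrow> 'a \<Rightarrow> 'a) \<Rightarrow> bool" where
  "closure_operator X M c \<longleftrightarrow>
    has_quasi_right_factorizations X M \<and>
    (\<forall>A \<in> Obj X. \<forall>m \<in> over X M A. c A m \<in> over X M A) \<and>
    (\<forall>A \<in> Obj X. \<forall>m \<in> over X M A. le X m (c A m)) \<and>
    (\<forall>A \<in> Obj X. \<forall>m \<in> over X M A. \<forall>m' \<in> over X M A.
      le X m m' \<longrightarrow> le X (c A m) (c A m')) \<and>
    (\<forall>A \<in> Obj X. \<forall>B \<in> Obj X. \<forall>f \<in> hom X A B. \<forall>m \<in> over X M A.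
      le X (quasi_right_part X M (Comp X f (c A m)))
           (c B (quasi_right_part X M (Comp X f m))))"

definition quasi_closed :: "('o, 'a, 'z) cat_scheme \<Rightarrow> ('o \<Rightarrow> 'a \<Rightarrow> 'a) \<Rightarrow> 'a \<Rightarrow> bool" where
  "quasi_closed X c m \<longleftrightarrow> equ X (c (Cod X m) m) m"

definition quasi_dense_in :: "('o, 'a, 'z) cat_scheme \<Rightarrow> ('o \<Rightarrow> 'a \<Rightarrow> 'a) \<Rightarrow> 'a \<Rightarrow> bool" where
  "quasi_dense_in X c m \<longleftrightarrow> equ X (c (Cod X m) m) (Ide X (Cod X m))"

text \<open>\<open>quasi_dense_in\<close> is density for members of \<open>M\<close>; \<open>quasi_dense\<close> is density
  for arbitrary morphisms.\<close>
definition quasi_dense ::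
    "('o, 'a, 'z) cat_scheme \<Rightarrow> 'a set \<Rightarrow> ('o \<Rightarrow> 'a \<Rightarrow> 'a) \<Rightarrow> 'a \<Rightarrow> bool" where
  "quasi_dense X M c f \<longleftrightarrow> quasi_dense_in X c (quasi_right_part X M f)"

definition M_QC :: "('o, 'a, 'z) cat_scheme \<Rightarrow> 'a set \<Rightarrow> ('o \<Rightarrow> 'a \<Rightarrow> 'a) \<Rightarrow> 'a set" where
  "M_QC X M c = {m \<in> M. quasi_closed X c m}"

definition E_QC :: "('o, 'a, 'z) cat_scheme \<Rightarrow> 'a set \<Rightarrow> ('o \<Rightarrow> 'a \<Rightarrow> 'a) \<Rightarrow> 'a set" where
  "E_QC X M c = {f \<in> Arr X. quasi_dense X M c f}"

definition quasi_idempotent ::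
    "('o, 'a, 'z) cat_scheme \<Rightarrow> 'a set \<Rightarrow> ('o \<Rightarrow> 'a \<Rightarrow> 'a) \<Rightarrow> bool" where
  "quasi_idempotent X M c \<longleftrightarrow>
    (\<forall>A \<in> Obj X. \<forall>m \<in> over X M A. equ X (c A (c A m)) (c A m))"

definition quasi_weakly_hereditary ::
    "('o, 'a, 'z) cat_scheme \<Rightarrow> 'a set \<Rightarrow> ('o \<Rightarrow> 'a \<Rightarrow> 'a) \<Rightarrow> bool" where
  "quasi_weakly_hereditary X M c \<longleftrightarrow>
    (\<forall>A \<in> Obj X. \<forall>m \<in> over X M A.
      \<exists>j \<in> hom X (Dom X m) (Dom X (c A m)). quasi_dense X M c j \<and> Comp X (c A m) j = m)"

definition QCD :: "('o, 'a, 'z) cat_scheme \<Rightarrow> 'a set \<Rightarrow> ('o \<Rightarrow> 'a \<Rightarrow> 'a) \<Rightarrow> bool" where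
  "QCD X M c \<longleftrightarrow>
    (\<forall>g f. composable X g f \<and> quasi_dense X M c g \<and> quasi_dense X M c f
      \<longrightarrow> quasi_dense X M c (Comp X g f))"

context category
begin

lemma le_iff:
  assumes "f \<in> Arr X" "g \<in> Arr X"
  shows "le X f g \<longleftrightarrow> (\<exists>j. composable X g j \<and> f = g \<cdot> j)"
proof
  assume "le X f g"
  moreover have "composable X f (Ide X (Dom X f))"
    using assms(1) Ide_in_hom[OF Dom_in_Obj[OF assms(1)]]
    by (simp add: composable_def hom_def)
  then have "f \<in> sieve X f"
    using Comp_Ide[OF assms(1)] unfolding sieve_def by (metis (mono_tags, lifting) mem_Collect_eq)
  ultimately show "\<exists>j. composable X g j \<and> f = g \<cdot> j"
    unfolding le_def sieve_def by blast
next
  assume "\<exists>j. composable X g j \<and> f = g \<cdot> j"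
  then obtain j where j: "composable X g j" "f = g \<cdot> j" by blast
  have f: "Dom X f = Dom X j" "Cod X f = Cod X g"
    using Comp_in_hom[OF j(1)] j(2) by (auto simp: hom_def)
  have "f \<cdot> h \<in> sieve X g" if "composable X f h" for h
  proof -
    have jh: "composable X j h"
      using that j(1) f by (simp add: composable_def)
    have "composable X g (j \<cdot> h)"
      using Comp_in_hom[OF jh] j(1) by (simp add: composable_def hom_def)
    then show ?thesis
      using Comp_assoc[OF j(1) jh] j(2) unfolding sieve_def by auto
  qed
  then show "le X f g"
    using assms f by (auto simp: le_def sieve_def)
qed

lemma is_quasi_right_part_unique:
  assumes "M \<subseteq> Arr X" "is_quasi_right_part X M f r" "is_quasi_right_part X M f s"
  shows "equ X r s"
proof -
  have "r \<in> Arr X" "s \<in> Arr X"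
    using assms by (auto simp: is_quasi_right_part_def over_def)
  then show ?thesis
    using assms(2,3) unfolding equ_def is_quasi_right_part_def by (simp add: le_iff)
qed

end

end

theory Submission
  imports Defs
begin

text \<open>
  The proof argues in the preorder \<^const>\<open>le\<close>, written \<open>\<le>\<close> here. The relation \<open>e \<down> m\<close> says that
  \<open>e \<le> m\<close> forces \<open>1 \<le> m\<close> (\<open>down_arrow_iff\<close>); a quasi mono can be cancelled from the left of an inequality
  (\<open>quasi_mono_cancel\<close>); and an inverse image \<open>p\<close> of \<open>m\<close> along \<open>f\<close> satisfies
  \<open>f \<cdot> a \<le> m \<longleftrightarrow> a \<le> p\<close> (\<open>pullback_adjoint\<close>). The quasi right part of \<open>f\<close> is the least
  member of \<open>M\<close> above \<open>f\<close>.

  For the equivalence, a dense morphism below a closed \<open>m\<close> forces \<open>1 \<le> m\<close>, because the closure of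
  its right part is already below \<open>m\<close>. If \<open>C\<close> is quasi idempotent, closures are closed, so
  conversely a morphism that has this property for all closed \<open>m\<close> has it for the closure of its own
  right part, and is dense. Hence \<open>\<E>\<^sup>Q\<^sup>C = \<^sup>\<down>\<M>\<^sup>Q\<^sup>C\<close>, and the stated inclusion is the only condition
  left besides the existence of factorizations. These always exist: write \<open>f\<close> as its right part
  \<open>r\<close> after some \<open>g\<close>, and \<open>r\<close> as its closure after a dense \<open>j\<close>. Minimality of \<open>r\<close> makes \<open>g\<close>
  dense, and (QCD) makes \<open>j \<cdot> g\<close> dense.

  For the second part, closed morphisms are stable under inverse images
  (\<open>obtain_closed_preimage\<close>), so that dense morphisms also cancel in the middle: if \<open>d\<close> is dense,
  \<open>m\<close> closed and \<open>t \<cdot> d \<le> m\<close>, then \<open>t \<le> m\<close> (\<open>dense_below_closed_cancel\<close>). Factor a composite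
  \<open>m \<cdot> n\<close> of closed morphisms as \<open>p \<cdot> d\<close>. Cancelling \<open>d\<close> twice gives \<open>p \<le> m \<cdot> n\<close>, so the composite
  is equivalent to the closed \<open>p\<close>. For a composite \<open>g \<cdot> f\<close> of dense morphisms, factor its right part
  \<open>r\<close> as \<open>p \<cdot> k\<close>; cancelling \<open>f\<close> and then \<open>g\<close> gives \<open>1 \<le> p\<close>, and continuity of the closure along
  \<open>p\<close> carries the density of \<open>k\<close> to \<open>p \<le> c r\<close>.
\<close>

section \<open>The factorization preorder\<close>

context category
begin

lemma composable_Arr:
  assumes "composable X g f"
  shows "g \<in> Arr X" "f \<in> Arr X" "Cod X f = Dom X g" "g \<cdot> f \<in> Arr X"
    "Dom X (g \<cdot> f) = Dom X f" "Cod X (g \<cdot> f) = Cod X g"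
  using assms Comp_in_hom[OF assms] by (auto simp: composable_def hom_def)

lemma Ide_Arr:
  assumes "A \<in> Obj X"
  shows "Ide X A \<in> Arr X" "Dom X (Ide X A) = A" "Cod X (Ide X A) = A"
  using Ide_in_hom[OF assms] by (auto simp: hom_def)

lemma composableI:
  assumes "g \<in> Arr X" "f \<in> Arr X" "Cod X f = Dom X g"
  shows "composable X g f"
  using assms by (simp add: composable_def)

lemma leD:
  assumes "le X f g"
  shows "f \<in> Arr X" "g \<in> Arr X" "Cod X f = Cod X g"
  using assms by (auto simp: le_def)

lemma le_refl: "f \<in> Arr X \<Longrightarrow> le X f f"
  by (simp add: le_def)

lemma le_trans [trans]: "le X f g \<Longrightarrow> le X g h \<Longrightarrow> le X f h"
  by (auto simp: le_def)

lemma Comp_le_left: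
  assumes "composable X g f"
  shows "le X (g \<cdot> f) g"
  using assms le_iff[OF composable_Arr(4,1)[OF assms]] by blast

lemma le_obtain:
  assumes "le X f g"
  obtains j where "composable X g j" "f = g \<cdot> j"
  using assms le_iff[OF leD(1,2)[OF assms]] by blast

lemma le_Ide:
  assumes "f \<in> Arr X"
  shows "le X f (Ide X (Cod X f))"
proof -
  note I = Ide_Arr[OF Cod_in_Obj[OF assms]]
  have "composable X (Ide X (Cod X f)) f" using assms I by (simp add: composableI)
  from Comp_le_left[OF this] show ?thesis using Ide_Comp[OF assms] by simp
qed

lemma equ_Ide_iff:
  assumes "f \<in> Arr X" "Cod X f = A"
  shows "equ X f (Ide X A) \<longleftrightarrow> le X (Ide X A) f"
  using le_Ide[OF assms(1)] assms(2) by (simp add: equ_def)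

lemma Comp_mono:
  assumes "composable X f b" "le X a b"
  shows "le X (f \<cdot> a) (f \<cdot> b)"
proof -
  obtain j where j: "composable X b j" "a = b \<cdot> j" using le_obtain[OF assms(2)] .
  have "composable X (f \<cdot> b) j"
    using composable_Arr[OF assms(1)] composable_Arr[OF j(1)] by (simp add: composable_def)
  from Comp_le_left[OF this] show ?thesis using Comp_assoc[OF assms(1) j(1)] j(2) by simp
qed

lemma le_Comp_if_Ide_le:
  assumes "composable X f a" "le X (Ide X (Dom X f)) a"
  shows "le X f (f \<cdot> a)"
  using Comp_mono[OF assms] Comp_Ide[OF composable_Arr(1)[OF assms(1)]] by simp

text \<open>Writing the smaller side as \<open>m \<cdot> (b \<cdot> j)\<close> turns the inequality into an equation, to which the
  defining property of quasi monos applies.\<close>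

lemma quasi_mono_cancel:
  assumes "quasi_mono X m" "composable X m a" "composable X m b" "le X (m \<cdot> a) (m \<cdot> b)"
  shows "le X a b"
proof -
  obtain j where j: "composable X (m \<cdot> b) j" "m \<cdot> a = (m \<cdot> b) \<cdot> j" using le_obtain[OF assms(4)] .
  have bj: "composable X b j"
    using composable_Arr[OF j(1)] composable_Arr[OF assms(3)] by (simp add: composable_def)
  have mbj: "composable X m (b \<cdot> j)"
    using assms(3) composable_Arr[OF bj] by (simp add: composable_def)
  have "m \<cdot> a = m \<cdot> (b \<cdot> j)" using j(2) Comp_assoc[OF assms(3) bj] by simp
  then have "sieve X a = sieve X (b \<cdot> j)"
    using assms(1,2) mbj unfolding quasi_mono_def by blast
  then have "le X a (b \<cdot> j)"
    using composable_Arr[OF assms(2)] composable_Arr[OF mbj] by (simp add: le_def)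
  then show ?thesis using Comp_le_left[OF bj] le_trans by blast
qed

lemma quasi_mono_cancel_Ide:
  assumes "quasi_mono X m" "composable X m b" "le X m (m \<cdot> b)"
  shows "le X (Ide X (Dom X m)) b"
proof (rule quasi_mono_cancel[OF assms(1) _ assms(2)])
  have m: "m \<in> Arr X" using composable_Arr[OF assms(2)] by simp
  show "composable X m (Ide X (Dom X m))"
    using m Ide_Arr[OF Dom_in_Obj[OF m]] by (simp add: composable_def)
  show "le X (m \<cdot> Ide X (Dom X m)) (m \<cdot> b)" using assms(3) Comp_Ide[OF m] by simp
qed

text \<open>The existence half of the universal property says that \<open>p\<close> is a greatest
  morphism that \<open>f\<close> carries below \<open>m\<close>.\<close>

lemma pullback_adjoint:
  assumes "is_pullback X f m p q" "composable X f a"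
  shows "le X (f \<cdot> a) m \<longleftrightarrow> le X a p"
proof
  assume "le X (f \<cdot> a) m"
  then obtain b where b: "composable X m b" "f \<cdot> a = m \<cdot> b" by (rule le_obtain)
  have "Dom X a = Dom X b"
    using b composable_Arr(5)[OF assms(2)] composable_Arr(5)[OF b(1)] by simp
  then obtain u where u: "u \<in> hom X (Dom X a) (Dom X p)" "p \<cdot> u = a"
    using assms b unfolding is_pullback_def by blast
  then have "composable X p u"
    using assms(1) by (auto simp: is_pullback_def composable_def hom_def)
  then show "le X a p" using Comp_le_left u by blast
next
  assume "le X a p"
  moreover have fp: "composable X f p" "f \<cdot> p = m \<cdot> q" "composable X m q"
    using assms(1) by (auto simp: is_pullback_def)
  ultimately have "le X (f \<cdot> a) (m \<cdot> q)" using Comp_mono[of f p a] by simp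
  also have "le X \<dots> m" using Comp_le_left[OF fp(3)] .
  finally show "le X (f \<cdot> a) m" .
qed

text \<open>Since everything lies below an identity, \<open>m \<cdot> w \<sim> 1\<close> for some \<open>w\<close> amounts to \<open>1 \<le> m\<close>.\<close>

lemma down_arrow_iff:
  assumes "e \<in> Arr X" "m \<in> Arr X" "Cod X e = Cod X m"
  shows "down_arrow X e m \<longleftrightarrow> (le X e m \<longrightarrow> le X (Ide X (Cod X m)) m)"
proof
  assume d: "down_arrow X e m"
  show "le X e m \<longrightarrow> le X (Ide X (Cod X m)) m"
  proof
    assume "le X e m"
    then obtain u where u: "composable X m u" "e = m \<cdot> u" by (rule le_obtain)
    have "u \<in> hom X (Dom X e) (Dom X m)"
      using composable_Arr[OF u(1)] u(2) by (simp add: hom_def)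
    then obtain w where w: "w \<in> hom X (Cod X m) (Dom X m)" "equ X (m \<cdot> w) (Ide X (Cod X m))"
      using d u(2) unfolding down_arrow_def by blast
    then have "composable X m w" using assms by (simp add: hom_def composable_def)
    from Comp_le_left[OF this] show "le X (Ide X (Cod X m)) m"
      using w(2) le_trans unfolding equ_def by blast
  qed
next
  assume r: "le X e m \<longrightarrow> le X (Ide X (Cod X m)) m"
  note I = Ide_Arr[OF Cod_in_Obj[OF assms(2)]]
  show "down_arrow X e m"
    unfolding down_arrow_def
  proof (intro ballI impI)
    fix u assume "u \<in> hom X (Dom X e) (Dom X m)" "e = m \<cdot> u"
    then have "le X e m" using Comp_le_left[of m u] assms by (auto simp: hom_def composable_def)
    then obtain w where w: "composable X m w" "Ide X (Cod X m) = m \<cdot> w"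
      using r le_obtain by blast
    have "w \<in> hom X (Cod X m) (Dom X m)"
      using composable_Arr[OF w(1)] I unfolding w(2)[symmetric] by (simp add: hom_def)
    moreover have "equ X (m \<cdot> w) (Ide X (Cod X m))"
      using I le_refl unfolding w(2)[symmetric] by (simp add: equ_def)
    ultimately show "\<exists>w\<in>hom X (Cod X m) (Dom X m). equ X (m \<cdot> w) (Ide X (Cod X m))" by blast
  qed
qed

end

section \<open>Closed and dense morphisms\<close>

locale category_with_closure = category X
  for X :: "('o, 'a, 'z) cat_scheme" (structure) +
  fixes M :: "'a set" and c :: "'o \<Rightarrow> 'a \<Rightarrow> 'a"
  assumes M_Arr: "M \<subseteq> Arr X"
    and closure: "closure_operator X M c"
begin

abbreviation right_part :: "'a \<Rightarrow> 'a" where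
  "right_part \<equiv> quasi_right_part X M"

abbreviation cl :: "'a \<Rightarrow> 'a" where
  "cl m \<equiv> c (Cod X m) m"

lemma right_part:
  assumes "f \<in> Arr X"
  shows "right_part f \<in> M" "Cod X (right_part f) = Cod X f" "le X f (right_part f)"
    and right_part_least: "m \<in> M \<Longrightarrow> le X f m \<Longrightarrow> le X (right_part f) m"
proof -
  have q: "is_quasi_right_part X M f (right_part f)"
    using closure assms
    unfolding closure_operator_def has_quasi_right_factorizations_def quasi_right_part_def
    by (metis someI_ex)
  then show rM: "right_part f \<in> M" "Cod X (right_part f) = Cod X f"
    by (auto simp: is_quasi_right_part_def over_def)
  have "\<exists>g. composable X (right_part f) g \<and> f = right_part f \<cdot> g"
    using q unfolding is_quasi_right_part_def by (elim conjE)
  then show "le X f (right_part f)"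
    using le_iff[OF assms] rM(1) M_Arr by (simp only: subsetD)
  assume m: "m \<in> M" "le X f m"
  have "m \<in> over X M (Cod X f)" "\<exists>g. composable X m g \<and> f = m \<cdot> g"
    using m leD(3)[OF m(2)] le_iff[OF leD(1,2)[OF m(2)]] by (simp_all add: over_def)
  then have "\<exists>h. composable X m h \<and> right_part f = m \<cdot> h"
    using q unfolding is_quasi_right_part_def by (elim conjE) (drule (1) bspec, drule (1) mp)
  then show "le X (right_part f) m"
    using le_iff[of "right_part f" m] rM(1) m(1) M_Arr by (simp only: subsetD)
qed

lemma cl:
  assumes "m \<in> M"
  shows "cl m \<in> M" "Cod X (cl m) = Cod X m" "le X m (cl m)"
proof -
  have "Cod X m \<in> Obj X" "m \<in> over X M (Cod X m)"
    using assms M_Arr Cod_in_Obj by (auto simp: over_def)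
  then have "cl m \<in> over X M (Cod X m)" "le X m (cl m)"
    using closure unfolding closure_operator_def by blast+
  then show "cl m \<in> M" "Cod X (cl m) = Cod X m" "le X m (cl m)" by (auto simp: over_def)
qed

lemma cl_mono:
  assumes "m \<in> M" "n \<in> M" "le X m n"
  shows "le X (cl m) (cl n)"
proof -
  have "Cod X m \<in> Obj X" "m \<in> over X M (Cod X m)" "n \<in> over X M (Cod X m)"
    using assms M_Arr Cod_in_Obj leD(3)[OF assms(3)] by (auto simp: over_def)
  then have "le X (c (Cod X m) m) (c (Cod X m) n)"
    using closure assms(3) unfolding closure_operator_def by blast
  then show ?thesis using leD(3)[OF assms(3)] by simp
qed

text \<open>The continuity axiom of a closure operator, with images replaced by upper bounds in \<open>M\<close>.\<close>

lemma cl_continuous: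
  assumes "m \<in> M" "n \<in> M" "composable X f m" "le X (f \<cdot> m) n"
  shows "le X (f \<cdot> cl m) (cl n)"
proof -
  have f: "f \<in> Arr X" "Cod X m = Dom X f" "f \<cdot> m \<in> Arr X" "Cod X (f \<cdot> m) = Cod X f"
    using composable_Arr[OF assms(3)] by simp_all
  have fc: "composable X f (cl m)"
    using f cl[OF assms(1)] M_Arr by (auto simp: composable_def)
  have "f \<in> hom X (Dom X f) (Cod X f)" "m \<in> over X M (Dom X f)"
    using f assms(1) by (auto simp: hom_def over_def)
  then have "le X (right_part (f \<cdot> c (Dom X f) m)) (c (Cod X f) (right_part (f \<cdot> m)))"
    using closure Dom_in_Obj[OF f(1)] Cod_in_Obj[OF f(1)]
    unfolding closure_operator_def by blast
  then have "le X (right_part (f \<cdot> cl m)) (cl (right_part (f \<cdot> m)))"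
    using f right_part(2)[OF f(3)] by simp
  moreover have "le X (f \<cdot> cl m) (right_part (f \<cdot> cl m))"
    using right_part(3) composable_Arr(4)[OF fc] by blast
  moreover have "le X (cl (right_part (f \<cdot> m))) (cl n)"
    using cl_mono right_part(1)[OF f(3)] right_part_least[OF f(3) assms(2,4)] assms(2) by blast
  ultimately show ?thesis using le_trans by blast
qed

lemma M_QC_iff: "m \<in> M_QC X M c \<longleftrightarrow> m \<in> M \<and> le X (cl m) m"
  using cl by (auto simp: M_QC_def quasi_closed_def equ_def)

lemma dense_iff:
  assumes "f \<in> Arr X"
  shows "quasi_dense X M c f \<longleftrightarrow> le X (Ide X (Cod X f)) (cl (right_part f))"
proof -
  note r = right_part[OF assms]
  note k = cl[OF r(1)]
  have "cl (right_part f) \<in> Arr X" using k M_Arr by blast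
  then show ?thesis
    unfolding quasi_dense_def quasi_dense_in_def using equ_Ide_iff k r(2) by metis
qed

lemma E_QC_iff: "f \<in> E_QC X M c \<longleftrightarrow> f \<in> Arr X \<and> quasi_dense X M c f"
  by (simp add: E_QC_def)

lemma M_QC_Arr: "M_QC X M c \<subseteq> Arr X"
  using M_Arr by (auto simp: M_QC_def)

lemma down_class_iff:
  "e \<in> down_class X (M_QC X M c) \<longleftrightarrow>
    e \<in> Arr X \<and> (\<forall>m \<in> M_QC X M c. le X e m \<longrightarrow> le X (Ide X (Cod X m)) m)"
proof
  assume e: "e \<in> down_class X (M_QC X M c)"
  then have eA: "e \<in> Arr X" by (simp add: down_class_def)
  have "le X (Ide X (Cod X m)) m" if "m \<in> M_QC X M c" "le X e m" for m
    using e that down_arrow_iff[of e m] leD[OF that(2)] by (simp add: down_class_def)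
  then show "e \<in> Arr X \<and> (\<forall>m \<in> M_QC X M c. le X e m \<longrightarrow> le X (Ide X (Cod X m)) m)"
    using eA by blast
next
  assume e: "e \<in> Arr X \<and> (\<forall>m \<in> M_QC X M c. le X e m \<longrightarrow> le X (Ide X (Cod X m)) m)"
  then show "e \<in> down_class X (M_QC X M c)"
    using M_QC_Arr down_arrow_iff[of e] by (auto simp: down_class_def subset_iff)
qed

text \<open>The right part of a dense \<open>e\<close> is the least member of \<open>M\<close> above \<open>e\<close>, so any closed \<open>m\<close> above
  \<open>e\<close> also lies above the closure of that right part, hence above the identity.\<close>

lemma E_QC_subset_down_class: "E_QC X M c \<subseteq> down_class X (M_QC X M c)"
proof
  fix e assume "e \<in> E_QC X M c"
  then have e: "e \<in> Arr X" "quasi_dense X M c e" by (auto simp: E_QC_iff)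
  have "le X (Ide X (Cod X m)) m" if m: "m \<in> M_QC X M c" "le X e m" for m
  proof -
    have mM: "m \<in> M" "le X (cl m) m" using m(1) by (auto simp: M_QC_iff)
    have "le X (Ide X (Cod X e)) (cl (right_part e))" using e dense_iff by blast
    also have "le X \<dots> (cl m)"
      using cl_mono right_part(1)[OF e(1)] right_part_least[OF e(1) mM(1) m(2)] mM(1) by blast
    also have "le X \<dots> m" by fact
    finally show ?thesis using leD(3)[OF m(2)] by simp
  qed
  then show "e \<in> down_class X (M_QC X M c)" using e(1) by (simp add: down_class_iff)
qed

lemma cl_in_M_QC:
  assumes "quasi_idempotent X M c" "m \<in> M"
  shows "cl m \<in> M_QC X M c"
proof -
  have "m \<in> over X M (Cod X m)" "Cod X m \<in> Obj X"
    using assms(2) M_Arr Cod_in_Obj by (auto simp: over_def)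
  then have "equ X (c (Cod X m) (cl m)) (cl m)"
    using assms(1) unfolding quasi_idempotent_def by blast
  then show ?thesis using cl[OF assms(2)] by (simp add: M_QC_iff equ_def)
qed

text \<open>The remaining inclusion tests \<open>e\<close> against the closure of its own right part, which is closed by
  idempotence.\<close>

lemma E_QC_eq_down_class:
  assumes "quasi_idempotent X M c"
  shows "E_QC X M c = down_class X (M_QC X M c)"
proof
  show "down_class X (M_QC X M c) \<subseteq> E_QC X M c"
  proof
    fix e assume e: "e \<in> down_class X (M_QC X M c)"
    then have eA: "e \<in> Arr X" by (simp add: down_class_iff)
    note r = right_part[OF eA]
    note k = cl[OF r(1)]
    have "le X e (cl (right_part e))" using r(3) k(3) le_trans by blast
    then have "le X (Ide X (Cod X e)) (cl (right_part e))"
      using e cl_in_M_QC[OF assms r(1)] k(2) r(2) by (auto simp: down_class_iff)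
    then show "e \<in> E_QC X M c" using eA dense_iff by (simp add: E_QC_iff)
  qed
qed (rule E_QC_subset_down_class)

text \<open>If \<open>n\<close> is the right part of \<open>g\<close>, then \<open>r \<cdot> n\<close> is a member of \<open>M\<close> above \<open>r \<cdot> g\<close>;
  minimality of \<open>r\<close> and cancellation of \<open>r\<close> give \<open>1 \<le> n\<close>.\<close>

lemma right_part_cofactor_dense:
  assumes "\<forall>m \<in> M. quasi_mono X m" "closed_under_comp X M"
    and rg: "composable X r g" and r_part: "right_part (r \<cdot> g) = r"
  shows "quasi_dense X M c g"
proof -
  note A = composable_Arr[OF rg]
  have rM: "r \<in> M" using right_part(1)[OF A(4)] r_part by simp
  note n = right_part[OF A(2)]
  have rn: "composable X r (right_part g)"
    using n A M_Arr by (auto simp: composable_def)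
  have "r \<cdot> right_part g \<in> M"
    using assms(2) rn rM n(1) unfolding closed_under_comp_def by blast
  moreover have "le X (r \<cdot> g) (r \<cdot> right_part g)"
    using Comp_mono[OF rn n(3)] .
  ultimately have "le X r (r \<cdot> right_part g)"
    using right_part_least[OF A(4)] r_part by metis
  then have "le X (Ide X (Cod X g)) (right_part g)"
    using quasi_mono_cancel_Ide[OF _ rn] rM assms(1) A(3) by simp
  then have "le X (Ide X (Cod X g)) (cl (right_part g))"
    using cl(3)[OF n(1)] le_trans by blast
  then show ?thesis using dense_iff[OF A(2)] by blast
qed

text \<open>The dense factor is \<open>j \<cdot> g\<close>, where \<open>g\<close> is what \<open>f\<close> leaves over its right part \<open>r\<close>, and \<open>j\<close>
  is what \<open>r\<close> leaves over its closure.\<close>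

lemma dense_closed_factorization:
  assumes "\<forall>m \<in> M. quasi_mono X m" "closed_under_comp X M"
    and "quasi_weakly_hereditary X M c" "quasi_idempotent X M c" "QCD X M c"
    and fA: "f \<in> Arr X"
  shows "\<exists>e \<in> E_QC X M c. \<exists>m \<in> M_QC X M c. composable X m e \<and> f = m \<cdot> e"
proof -
  define r where "r = right_part f"
  have r: "r \<in> M" "Cod X r = Cod X f" "le X f r" using right_part[OF fA] by (auto simp: r_def)
  note k = cl[OF r(1)]
  obtain g where g: "composable X r g" "f = r \<cdot> g" using le_obtain[OF r(3)] .
  have gd: "quasi_dense X M c g"
  proof (rule right_part_cofactor_dense[OF assms(1,2) g(1)])
    show "right_part (r \<cdot> g) = r" unfolding g(2)[symmetric] by (rule r_def[symmetric])
  qed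
  have "r \<in> over X M (Cod X r)" "Cod X r \<in> Obj X"
    using r(1) M_Arr Cod_in_Obj[of r] by (auto simp: over_def)
  then obtain j where j: "j \<in> hom X (Dom X r) (Dom X (cl r))" "quasi_dense X M c j" "cl r \<cdot> j = r"
    using assms(3) unfolding quasi_weakly_hereditary_def by blast
  have jg: "composable X j g" using j(1) composable_Arr[OF g(1)] by (simp add: hom_def composable_def)
  have kj: "composable X (cl r) j" using j(1) k M_Arr by (auto simp: hom_def composable_def)
  have "quasi_dense X M c (j \<cdot> g)" using assms(5) jg j(2) gd unfolding QCD_def by blast
  then have "j \<cdot> g \<in> E_QC X M c" using composable_Arr(4)[OF jg] by (simp add: E_QC_iff)
  moreover have "composable X (cl r) (j \<cdot> g)"
    using kj composable_Arr[OF jg] by (simp add: composable_def)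
  moreover have "f = cl r \<cdot> (j \<cdot> g)" using Comp_assoc[OF kj jg] j(3) g(2) by simp
  ultimately show ?thesis using cl_in_M_QC[OF assms(4) r(1)] by blast
qed

section \<open>Inverse images of closed morphisms\<close>

lemma obtain_preimage:
  assumes "has_pullbacks X M" "m \<in> M" "f \<in> Arr X" "Cod X f = Cod X m"
  obtains p where "p \<in> M" "composable X f p"
    "\<And>a. composable X f a \<Longrightarrow> le X (f \<cdot> a) m \<longleftrightarrow> le X a p"
proof -
  obtain p q where pq: "is_pullback X f m p q" "p \<in> M"
    using assms unfolding has_pullbacks_def by blast
  moreover from pq(1) have "composable X f p" by (simp add: is_pullback_def)
  ultimately show thesis using that pullback_adjoint by blast
qed

text \<open>By continuity, \<open>f\<close> carries the closure of the inverse image of \<open>m\<close> below the closure of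
  \<open>m\<close>, that is, below \<open>m\<close>.\<close>

lemma obtain_closed_preimage:
  assumes "has_pullbacks X M" "m \<in> M_QC X M c" "f \<in> Arr X" "Cod X f = Cod X m"
  obtains p where "p \<in> M_QC X M c" "composable X f p"
    "\<And>a. composable X f a \<Longrightarrow> le X (f \<cdot> a) m \<longleftrightarrow> le X a p"
proof -
  have m: "m \<in> M" "le X (cl m) m" using assms(2) by (auto simp: M_QC_iff)
  obtain p where p: "p \<in> M" "composable X f p"
    "\<And>a. composable X f a \<Longrightarrow> le X (f \<cdot> a) m \<longleftrightarrow> le X a p"
    using obtain_preimage[OF assms(1) m(1) assms(3,4)] by blast
  have pA: "p \<in> Arr X" using p(1) M_Arr by blast
  have "le X (f \<cdot> p) m" using p(3)[OF p(2)] le_refl[OF pA] by blast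
  then have "le X (f \<cdot> cl p) m" using cl_continuous[OF p(1) m(1) p(2)] m(2) le_trans by blast
  moreover have "composable X f (cl p)"
    using p(2) cl[OF p(1)] M_Arr by (auto simp: composable_def)
  ultimately have "le X (cl p) p" using p(3) by blast
  then show thesis using that p by (simp add: M_QC_iff)
qed

lemma dense_below_closed_cancel:
  assumes "has_pullbacks X M" "d \<in> E_QC X M c" "m \<in> M_QC X M c"
    and td: "composable X t d" and le: "le X (t \<cdot> d) m"
  shows "le X t m"
proof -
  have t: "t \<in> Arr X" "Cod X t = Cod X m" using composable_Arr[OF td] leD(3)[OF le] by auto
  obtain p where p: "p \<in> M_QC X M c" "composable X t p"
    "\<And>a. composable X t a \<Longrightarrow> le X (t \<cdot> a) m \<longleftrightarrow> le X a p"
    using obtain_closed_preimage[OF assms(1,3) t] by blast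
  have "le X d p" using p(3)[OF td] le by blast
  then have "le X (Ide X (Cod X p)) p"
    using p(1) assms(2) E_QC_subset_down_class down_class_iff by blast
  then have "le X t (t \<cdot> p)" using le_Comp_if_Ide_le[OF p(2)] composable_Arr(3)[OF p(2)] by simp
  moreover have "le X (t \<cdot> p) m" using p(3)[OF p(2)] le_refl composable_Arr(2)[OF p(2)] by blast
  ultimately show ?thesis using le_trans by blast
qed

section \<open>Consequences of dense-closed factorizations\<close>

text \<open>A factorization \<open>m \<cdot> n = p \<cdot> d\<close> with \<open>d\<close> dense and \<open>p\<close> closed first gives \<open>p \<le> m\<close>, say
  \<open>p = m \<cdot> t\<close>; cancelling \<open>m\<close> leaves \<open>t \<cdot> d \<le> n\<close>, and so \<open>t \<le> n\<close>. Thus \<open>p \<le> m \<cdot> n\<close>.\<close>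

lemma M_QC_closed_under_comp:
  assumes pb: "has_pullbacks X M" and mono: "\<forall>m \<in> M. quasi_mono X m"
    and comp: "closed_under_comp X M"
    and fact: "\<And>f. f \<in> Arr X \<Longrightarrow>
      \<exists>e \<in> E_QC X M c. \<exists>m \<in> M_QC X M c. composable X m e \<and> f = m \<cdot> e"
  shows "closed_under_comp X (M_QC X M c)"
  unfolding closed_under_comp_def
proof (intro ballI impI)
  fix m n assume m: "m \<in> M_QC X M c" and n: "n \<in> M_QC X M c" and mn: "composable X m n"
  have M: "m \<in> M" "n \<in> M" using m n by (auto simp: M_QC_iff)
  have mnM: "m \<cdot> n \<in> M" using comp M mn unfolding closed_under_comp_def by blast
  obtain d p where d: "d \<in> E_QC X M c" and p: "p \<in> M_QC X M c"
    and pd: "composable X p d" "m \<cdot> n = p \<cdot> d"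
    using fact[OF composable_Arr(4)[OF mn]] by blast
  have pM: "p \<in> M" "le X (cl p) p" using p by (auto simp: M_QC_iff)
  have "le X (p \<cdot> d) m" using Comp_le_left[OF mn] pd(2) by simp
  then have "le X p m" using dense_below_closed_cancel[OF pb d m pd(1)] by blast
  then obtain t where t: "composable X m t" "p = m \<cdot> t" by (rule le_obtain)
  have td: "composable X t d"
    using composable_Arr[OF pd(1)] composable_Arr[OF t(1)] t(2) by (simp add: composable_def)
  have mtd: "composable X m (t \<cdot> d)"
    using t(1) composable_Arr[OF td] by (simp add: composable_def)
  have "m \<cdot> (t \<cdot> d) = m \<cdot> n" using Comp_assoc[OF t(1) td] t(2) pd(2) by simp
  then have "le X (m \<cdot> (t \<cdot> d)) (m \<cdot> n)" using le_refl composable_Arr(4)[OF mn] by simp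
  then have "le X (t \<cdot> d) n" using quasi_mono_cancel[OF _ mtd mn] mono M by blast
  then have "le X t n" using dense_below_closed_cancel[OF pb d n td] by blast
  then have "le X p (m \<cdot> n)" using Comp_mono[OF mn] t(2) by simp
  moreover have "le X (m \<cdot> n) p" using Comp_le_left[OF pd(1)] pd(2) by simp
  ultimately have "le X (cl (m \<cdot> n)) (m \<cdot> n)"
    using cl_mono[OF mnM pM(1)] pM(2) le_trans by blast
  then show "m \<cdot> n \<in> M_QC X M c" using mnM by (simp add: M_QC_iff)
qed

text \<open>It is the closure of the right part \<open>r\<close> of \<open>g \<cdot> f\<close> that must lie above the identity, and
  without idempotence this closure need not be closed. The factorization \<open>r = p \<cdot> k\<close> supplies a
  closed \<open>p\<close> instead; cancelling \<open>f\<close> and \<open>g\<close> gives \<open>1 \<le> p\<close>, and the density of \<open>k\<close> gives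
  \<open>p \<le> cl r\<close>.\<close>

lemma QCD_of_factorizations:
  assumes pb: "has_pullbacks X M"
    and fact: "\<And>f. f \<in> Arr X \<Longrightarrow>
      \<exists>e \<in> E_QC X M c. \<exists>m \<in> M_QC X M c. composable X m e \<and> f = m \<cdot> e"
  shows "QCD X M c"
  unfolding QCD_def
proof (intro allI impI)
  fix g f assume a: "composable X g f \<and> quasi_dense X M c g \<and> quasi_dense X M c f"
  then have gf: "composable X g f" by blast
  have E: "g \<in> E_QC X M c" "f \<in> E_QC X M c"
    using a composable_Arr[OF gf] by (auto simp: E_QC_iff)
  have gfA: "g \<cdot> f \<in> Arr X" "Cod X (g \<cdot> f) = Cod X g" using composable_Arr[OF gf] by auto
  define r where "r = right_part (g \<cdot> f)"
  have r: "r \<in> M" "Cod X r = Cod X g" "le X (g \<cdot> f) r"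
    using right_part[OF gfA(1)] gfA(2) by (auto simp: r_def)
  have rA: "r \<in> Arr X" using r M_Arr by blast
  obtain k p where k: "k \<in> E_QC X M c" and p: "p \<in> M_QC X M c"
    and pk: "composable X p k" "r = p \<cdot> k"
    using fact[OF rA] by blast
  note pA = composable_Arr[OF pk(1)]
  have pcod: "Cod X p = Cod X r" using pA pk(2) by simp
  have "le X r p" using Comp_le_left[OF pk(1)] unfolding pk(2)[symmetric] .
  then have "le X (g \<cdot> f) p" using r(3) le_trans by blast
  then have "le X g p" using dense_below_closed_cancel[OF pb E(2) p gf] by blast
  then have one_p: "le X (Ide X (Cod X p)) p"
    using E(1) p E_QC_subset_down_class down_class_iff by blast
  \<comment> \<open>The image of the right part of \<open>k\<close> under \<open>p\<close> is below \<open>r\<close>, since the inverse image of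
    \<open>r\<close> along \<open>p\<close> is a member of \<open>M\<close> above \<open>k\<close>.\<close>
  obtain s where s: "s \<in> M" "composable X p s"
    "\<And>a. composable X p a \<Longrightarrow> le X (p \<cdot> a) r \<longleftrightarrow> le X a s"
    using obtain_preimage[OF pb r(1) pA(1) pcod] by blast
  have kA: "k \<in> Arr X" using pA by blast
  note n = right_part[OF kA]
  have pn: "composable X p (right_part k)" using n pA M_Arr by (auto simp: composable_def)
  have "le X k s" using s(3)[OF pk(1)] pk(2) le_refl[OF rA] by simp
  then have "le X (right_part k) s" using right_part_least[OF kA s(1)] by blast
  then have "le X (p \<cdot> right_part k) r" using s(3)[OF pn] by blast
  then have pcr: "le X (p \<cdot> cl (right_part k)) (cl r)" using cl_continuous[OF n(1) r(1) pn] by blast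
  have pc: "composable X p (cl (right_part k))"
    using cl[OF n(1)] n(2) pA M_Arr by (auto simp: composable_def)
  have "le X (Ide X (Dom X p)) (cl (right_part k))"
    using k dense_iff[OF kA] pA(3) by (simp add: E_QC_iff)
  then have "le X p (p \<cdot> cl (right_part k))" using le_Comp_if_Ide_le[OF pc] by blast
  then have "le X (Ide X (Cod X p)) (cl r)" using one_p pcr le_trans by blast
  then show "quasi_dense X M c (g \<cdot> f)"
    using dense_iff[OF gfA(1)] gfA(2) pcod r(2) by (simp add: r_def)
qed

end

theorem theorem5p13:
  fixes X :: "('o, 'a) cat"
    and E M :: "'a set"
    and c :: "'o \<Rightarrow> 'a \<Rightarrow> 'a"
  assumes "category X"
    and "quasi_factorization_structure X E M"
    and "\<forall>m \<in> M. quasi_mono X m"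
    and "has_pullbacks X M"
    and "closed_under_comp X M"
    and "closure_operator X M c"
  shows
    "(closed_under_comp_iso X M \<and> quasi_weakly_hereditary X M c \<and> quasi_idempotent X M c \<and>
        QCD X M c \<longrightarrow>
      (quasi_factorization_structure X (E_QC X M c) (M_QC X M c) \<longleftrightarrow>
        M_QC X M c \<subseteq> up_class X (down_class X (M_QC X M c))))
     \<and>
     (quasi_factorization_structure X (E_QC X M c) (M_QC X M c) \<longrightarrow>
        closed_under_comp X (M_QC X M c) \<and> QCD X M c)"
proof -
  interpret category X by fact
  interpret category_with_closure X M c
    by unfold_locales (use assms(2,6) in \<open>auto simp: quasi_factorization_structure_def\<close>)
  have "quasi_factorization_structure X (E_QC X M c) (M_QC X M c) \<longleftrightarrow>
      M_QC X M c \<subseteq> up_class X (down_class X (M_QC X M c))"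
    if h: "quasi_weakly_hereditary X M c" "quasi_idempotent X M c" "QCD X M c"
  proof -
    have "E_QC X M c \<subseteq> Arr X" by (auto simp: E_QC_iff)
    then show ?thesis
      using dense_closed_factorization[OF assms(3,5) h] M_QC_Arr E_QC_eq_down_class[OF h(2)]
      unfolding quasi_factorization_structure_def by auto
  qed
  moreover have "closed_under_comp X (M_QC X M c) \<and> QCD X M c"
    if q: "quasi_factorization_structure X (E_QC X M c) (M_QC X M c)"
  proof -
    have "\<exists>e \<in> E_QC X M c. \<exists>m \<in> M_QC X M c. composable X m e \<and> f = Comp X m e"
      if "f \<in> Arr X" for f
      using q that unfolding quasi_factorization_structure_def by blast
    then show ?thesis
      using M_QC_closed_under_comp[OF assms(4,3,5)] QCD_of_factorizations[OF assms(4)] by blast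
  qed
  ultimately show ?thesis by blast
qed

end
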